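(* Every infinite prime poset with no infinite chain embeds a member of $\mathcal Q=\{Q_0, Q_1, Q_1^*, Q_2, Q_3, Q_3^*\}$.
   Context: For a poset $P=(V,\le)$, $P^*$ denotes its dual (same set, reversed order). A subset $A\subseteq V$ is autonomous in $P$ if for all $v\in V\setminus A$ and all $a,a'\in A$: $v<a$ implies $v<a'$, and $a<v$ implies $a'<v$. The empty set, the singletons and $V$ are the trivial autonomous sets. $P$ is prime if it has more than three elements and all its autonomous sets are trivial. A poset $P$ embeds a poset $P'$ if $P'$ is isomorphic to an induced subposet of $P$. The posets $Q_0,Q_1,Q_2$ have underlying set $A\cup B$ with $A=\{a_i: i\in\mathbb N\}$, $B=\{b_i: i\in\mathbb N\}$ disjoint (all listed elements distinct); $Q_3$ has underlying set $A\cup B\cup\{c\}$ with $c$ a new element. The only strict comparabilities are: - in $Q_0$: $a_i<b_j$ iff $i\ne j$; - in $Q_1$: $a_i<b_j$ iff $i\le j$; - in $Q_2$: $a_i<b_j$ iff $j=i$ or $j=i+1$; - in $Q_3$: $a_i<b_i$ and $c<b_i$ for all $i\in\mathbb N$. *)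

theory Defs
  imports Main
begin

text \<open>
  A poset with underlying set \<open>V\<close> is given by a reflexive order relation \<open>r\<close> with
  \<open>partial_order_on V r\<close> (so \<open>r \<subseteq> V \<times> V\<close>); its strict order is \<open>r - Id\<close>.
\<close>

definition autonomous :: "'a set \<Rightarrow> 'a rel \<Rightarrow> 'a set \<Rightarrow> bool" where
  "autonomous V r A \<longleftrightarrow> A \<subseteq> V \<and>
     (\<forall>v \<in> V - A. \<forall>a \<in> A. \<forall>a' \<in> A.
        ((v, a) \<in> r - Id \<longrightarrow> (v, a') \<in> r - Id) \<and>
        ((a, v) \<in> r - Id \<longrightarrow> (a', v) \<in> r - Id))"

text \<open>
  The disjunct \<open>infinite V\<close> is needed because \<open>card V = 0\<close> for infinite \<open>V\<close>.
\<close>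

definition prime_poset :: "'a set \<Rightarrow> 'a rel \<Rightarrow> bool" where
  "prime_poset V r \<longleftrightarrow> partial_order_on V r \<and>
     (infinite V \<or> card V > 3) \<and>
     (\<forall>A. autonomous V r A \<longrightarrow> A = {} \<or> (\<exists>v. A = {v}) \<or> A = V)"

text \<open>
  The library's \<open>embed\<close> and \<open>iso\<close> (for well-orders) are stated through initial segments,
  so they are not used here.
\<close>

definition isomorphic_posets :: "'a set \<Rightarrow> 'a rel \<Rightarrow> 'b set \<Rightarrow> 'b rel \<Rightarrow> bool" where
  "isomorphic_posets V r W s \<longleftrightarrow>
     (\<exists>f. bij_betw f V W \<and> (\<forall>x \<in> V. \<forall>y \<in> V. (x, y) \<in> r \<longleftrightarrow> (f x, f y) \<in> s))"

definition embeds_poset :: "'a set \<Rightarrow> 'a rel \<Rightarrow> 'b set \<Rightarrow> 'b rel \<Rightarrow> bool" where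
  "embeds_poset V r W s \<longleftrightarrow> (\<exists>S \<subseteq> V. isomorphic_posets W s S (r \<inter> S \<times> S))"

datatype q_elem = Qa nat | Qb nat | Qc

definition AB :: "q_elem set" where
  "AB = range Qa \<union> range Qb"

definition ABC :: "q_elem set" where
  "ABC = range Qa \<union> range Qb \<union> {Qc}"

definition Q0 :: "q_elem rel" where
  "Q0 = Id_on AB \<union> {(Qa i, Qb j) | i j. i \<noteq> j}"

definition Q1 :: "q_elem rel" where
  "Q1 = Id_on AB \<union> {(Qa i, Qb j) | i j. i \<le> j}"

definition Q2 :: "q_elem rel" where
  "Q2 = Id_on AB \<union> {(Qa i, Qb j) | i j. j = i \<or> j = i + 1}"

definition Q3 :: "q_elem rel" where
  "Q3 = Id_on ABC \<union> {(Qa i, Qb i) | i. True} \<union> {(Qc, Qb i) | i. True}"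

text \<open>The converse relation gives the dual poset.\<close>

definition Q_family :: "(q_elem set \<times> q_elem rel) set" where
  "Q_family = {(AB, Q0), (AB, Q1), (AB, Q1\<inverse>), (AB, Q2), (ABC, Q3), (ABC, Q3\<inverse>)}"

lemma Q_family_partial_order:
  assumes "(W, s) \<in> Q_family"
  shows "partial_order_on W s"
proof -
  have "partial_order_on AB Q0" "partial_order_on AB Q1" "partial_order_on AB Q2"
    "partial_order_on ABC Q3"
    by (auto simp: partial_order_on_def preorder_on_def refl_on_def trans_def antisym_def
        Q0_def Q1_def Q2_def Q3_def AB_def ABC_def)
  then show ?thesis
    using assms by (auto simp: Q_family_def)
qed

end

theory Submission
  imports Defs "HOL-Library.Ramsey"
begin

text \<open>
  Since there are no infinite chains, there is an infinite set \<open>I\<close> whose comparability graph is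
  locally finite and which is either \<open>V\<close>, or the set of elements above some \<open>c\<close> (with \<open>c\<close> maximal
  among the elements with infinitely many upper bounds), or an open interval \<open>]c, y[\<close> (with \<open>y\<close>
  minimal above such a \<open>c\<close>), up to duality. An element outside \<open>I\<close> that distinguishes elements of
  \<open>I\<close> lies above some of them and is incomparable to \<open>y\<close>, or lies below some of them and is
  incomparable to \<open>c\<close>.

  If the comparability graph of \<open>I\<close> has an infinite component, a geodesic ray in it is a copy of
  \<open>Q2\<close>. Otherwise it has infinitely many finite components, and primality provides outer elements
  that separate the isolated vertices from each other or split the nontrivial components. By Ramsey's
  theorem, outer elements and elements of \<open>I\<close> are related by one of the patterns \<open>i = j\<close>, \<open>i \<noteq> j\<close>,
  \<open>i \<le> j\<close>, \<open>j \<le> i\<close>. The first, completed by \<open>y\<close> or \<open>c\<close>, yields \<open>Q3\<close> or its dual; the others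
  yield \<open>Q0\<close>, \<open>Q1\<close> and the dual of \<open>Q1\<close>. If a single outer element splits infinitely many
  components, it is itself the centre of a copy of \<open>Q3\<close> or its dual.
\<close>

section \<open>Ramsey's theorem and regular patterns between two sequences\<close>

lemma ramsey_sequence:
  fixes g :: "nat \<Rightarrow> nat \<Rightarrow> 'c::finite"
  shows "\<exists>(h :: nat \<Rightarrow> nat) t. strict_mono h \<and> (\<forall>i j. i < j \<longrightarrow> g (h i) (h j) = t)"
proof -
  obtain e :: "'c \<Rightarrow> nat" and s where e: "e ` UNIV = {..<s}" "inj e"
    using finite_imp_inj_to_nat_seg[of "UNIV :: 'c set"] by (auto simp: lessThan_def)
  \<comment> \<open>\<open>Ramsey2\<close> colours unordered pairs by numbers: \<open>Min\<close>
    and \<open>Max\<close> recover the order of the pair, and \<open>e\<close> numbers the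
    colours.\<close>
  define f where "f A = e (g (Min A) (Max A))" for A
  have "\<forall>x\<in>UNIV. \<forall>y\<in>UNIV. x \<noteq> y \<longrightarrow> f {x, y} < s"
    using e(1) by (auto simp: f_def)
  from Ramsey2[OF infinite_UNIV_nat this] obtain Y t where Y: "infinite Y"
    "\<forall>x\<in>Y. \<forall>y\<in>Y. x \<noteq> y \<longrightarrow> f {x, y} = t" by blast
  define h where "h = enumerate Y"
  have h: "strict_mono h" "\<And>i. h i \<in> Y"
    using Y(1) by (simp_all add: h_def strict_mono_enumerate enumerate_in_set)
  have "e (g (h i) (h j)) = t" if "i < j" for i j
  proof -
    have "h i < h j" using h(1) that by (simp add: strict_mono_less)
    then show ?thesis using Y(2)[rule_format, OF h(2) h(2), of i j] by (simp add: f_def)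
  qed
  then have "g (h i) (h j) = inv e t" if "i < j" for i j
    using that e(2) by (metis inv_f_f)
  with h(1) show ?thesis by blast
qed

text \<open>The pattern \<open>i < j\<close> does not occur in the list since a shift turns it into \<open>i \<le> j\<close>.\<close>

definition regular_pattern :: "(nat \<Rightarrow> nat \<Rightarrow> bool) \<Rightarrow> bool" where
  "regular_pattern S \<longleftrightarrow> (\<forall>i j. S i j = (i = j)) \<or> (\<forall>i j. S i j = (i \<noteq> j)) \<or>
     (\<forall>i j. S i j = (i \<le> j)) \<or> (\<forall>i j. S i j = (j \<le> i))"

lemma regular_pattern_strict_mono:
  assumes "regular_pattern S" "strict_mono h"
  shows "regular_pattern (\<lambda>i j. S (h i) (h j))"
  using assms by (auto simp: regular_pattern_def strict_mono_less_eq strict_mono_eq)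

text \<open>In each of the four patterns, rows \<open>i < j\<close> differ in column
  \<open>i\<close> or in column \<open>j\<close>.\<close>

lemma regular_pattern_inj:
  assumes "regular_pattern (\<lambda>i j. R (w i) (u j))"
  shows "inj w"
proof -
  have "R (w i) (u i) \<noteq> R (w j) (u i) \<or> R (w i) (u j) \<noteq> R (w j) (u j)" if "i < j" for i j
    using assms that unfolding regular_pattern_def by auto
  then show ?thesis
    by (metis injI linorder_neqE_nat)
qed

text \<open>Of the eight triples \<open>(p, q, s)\<close> the two constant ones are excluded. Four
  others are regular patterns; the two strict orders become weak ones when the columns or the rows
  are shifted by one, so rows and columns need separate subsequences.\<close>

lemma regular_pattern_of_constant:
  fixes S :: "nat \<Rightarrow> nat \<Rightarrow> bool"
  assumes "\<And>i. S i i = p" "\<And>i j. i < j \<Longrightarrow> S i j = q" "\<And>i j. i < j \<Longrightarrow> S j i = s"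
    and "p \<noteq> q \<or> p \<noteq> s"
  shows "\<exists>h k. strict_mono (h :: nat \<Rightarrow> nat) \<and> strict_mono (k :: nat \<Rightarrow> nat) \<and>
    regular_pattern (\<lambda>i j. S (h i) (k j))"
proof -
  have S: "S i j = (if i = j then p else if i < j then q else s)" for i j
    using assms(1-3) by (cases i j rule: linorder_cases) auto
  have m: "strict_mono (\<lambda>i::nat. i)" "strict_mono Suc"
    by (auto simp: strict_mono_def)
  have "regular_pattern S" if "\<not> (p = False \<and> q = True \<and> s = False)"
      "\<not> (p = False \<and> q = False \<and> s = True)"
    using assms(4) that by (cases p; cases q; cases s) (auto simp: S regular_pattern_def)
  moreover have "regular_pattern (\<lambda>i j. S i (Suc j))" if "p = False \<and> q = True \<and> s = False"
    using that by (auto simp: S regular_pattern_def)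
  moreover have "regular_pattern (\<lambda>i j. S (Suc i) j)" if "p = False \<and> q = False \<and> s = True"
    using that by (auto simp: S regular_pattern_def)
  ultimately show ?thesis using m by blast
qed

text \<open>Both matrices are made homogeneous by Ramsey's theorem. If they disagree above the
  diagonal, a single row separates infinitely many pairs. If they agree there, one of them differs
  from its own diagonal, because the diagonals are complementary, and so contains a regular
  pattern.\<close>

lemma regular_pattern_of_separating_pairs:
  fixes S S' :: "nat \<Rightarrow> nat \<Rightarrow> bool"
  assumes "\<And>i. S i i \<noteq> S' i i"
  shows "(\<exists>i k. strict_mono (k :: nat \<Rightarrow> nat) \<and> (\<forall>j. S i (k j) \<noteq> S' i (k j))) \<or>
    (\<exists>h k. strict_mono (h :: nat \<Rightarrow> nat) \<and> strict_mono (k :: nat \<Rightarrow> nat) \<and>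
      (regular_pattern (\<lambda>i j. S (h i) (k j)) \<or> regular_pattern (\<lambda>i j. S' (h i) (k j))))"
proof -
  obtain h :: "nat \<Rightarrow> nat" and t where h: "strict_mono h" and t: "\<forall>i j. i < j \<longrightarrow>
      (S (h i) (h i), S (h i) (h j), S (h j) (h i), S' (h i) (h j), S' (h j) (h i)) = t"
    using ramsey_sequence[of "\<lambda>i j. (S i i, S i j, S j i, S' i j, S' j i)"] by blast
  obtain p q s q' s' where "t = (p, q, s, q', s')" by (cases t)
  with t have c: "S (h i) (h i) = p" "S (h i) (h j) = q" "S (h j) (h i) = s"
    "S' (h i) (h j) = q'" "S' (h j) (h i) = s'" if "i < j" for i j
    using that by auto
  have p: "S (h i) (h i) = p" "S' (h i) (h i) = (\<not> p)" for i
    using c(1)[of i "Suc i"] assms by auto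
  show ?thesis
  proof (cases "q = q'")
    case False
    have "S (h 0) (h (Suc j)) \<noteq> S' (h 0) (h (Suc j))" for j
      using c(2,4)[of 0 "Suc j"] False by simp
    moreover have "strict_mono (\<lambda>j. h (Suc j))"
      using h by (simp add: strict_mono_def)
    ultimately show ?thesis by blast
  next
    case True
    consider "p \<noteq> q" | "(\<not> p) \<noteq> q'" using True by blast
    then have "\<exists>h' k'. strict_mono h' \<and> strict_mono k' \<and>
      (regular_pattern (\<lambda>i j. S (h (h' i)) (h (k' j))) \<or>
       regular_pattern (\<lambda>i j. S' (h (h' i)) (h (k' j))))"
    proof cases
      case 1
      then show ?thesis
        using regular_pattern_of_constant[of "\<lambda>i j. S (h i) (h j)" p q s] c p by blast
    next
      case 2
      then show ?thesis
        using regular_pattern_of_constant[of "\<lambda>i j. S' (h i) (h j)" "\<not> p" q' s'] c p by blast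
    qed
    moreover have comp: "strict_mono (h \<circ> k)" if "strict_mono k" for k :: "nat \<Rightarrow> nat"
      using h that by (simp add: strict_mono_def)
    ultimately obtain h' k' where "strict_mono h'" "strict_mono k'"
      "regular_pattern (\<lambda>i j. S ((h \<circ> h') i) ((h \<circ> k') j)) \<or>
       regular_pattern (\<lambda>i j. S' ((h \<circ> h') i) ((h \<circ> k') j))"
      by auto
    then show ?thesis
      using comp by blast
  qed
qed

text \<open>Points are drawn from shrinking infinite sets so that \<open>w n\<close> treats
  \<open>x n\<close> differently from all later points. After homogenization the diagonal therefore
  differs from the entries above it.\<close>

lemma regular_pattern_of_separation:
  assumes X: "infinite X" and sep: "\<And>x y. x \<in> X \<Longrightarrow> y \<in> X \<Longrightarrow> x \<noteq> y \<Longrightarrow> \<exists>w\<in>W. R w x \<noteq> R w y"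
  shows "\<exists>w x. (\<forall>n::nat. w n \<in> W) \<and> (\<forall>n::nat. x n \<in> X) \<and> regular_pattern (\<lambda>i j. R (w i) (x j))"
proof -
  define I where "I = (\<lambda>(Y, w, x). infinite Y \<and> Y \<subseteq> X \<and> w \<in> W \<and> x \<in> X \<and> (\<forall>z\<in>Y. R w z \<noteq> R w x))"
  have step: "\<exists>Y' w x. I (Y', w, x) \<and> Y' \<subseteq> Y \<and> x \<in> Y" if Y: "infinite Y" "Y \<subseteq> X" for Y
  proof -
    obtain a where a: "a \<in> Y" using Y(1) by fastforce
    have "infinite (Y - {a})" using Y(1) by simp
    then obtain b where b: "b \<in> Y" "b \<noteq> a"
      using infinite_imp_nonempty by blast
    obtain w where w: "w \<in> W" "R w a \<noteq> R w b" using sep a b Y(2) by blast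
    \<comment> \<open>As \<open>w\<close> distinguishes \<open>a\<close> from \<open>b\<close>, each
      point of \<open>Y\<close> disagrees with one of them. An infinite class becomes the next set,
      and the point it disagrees with becomes \<open>x\<close>.\<close>
    let ?A = "{z \<in> Y. R w z \<noteq> R w a}" and ?B = "{z \<in> Y. R w z \<noteq> R w b}"
    have "Y = ?A \<union> ?B" using w(2) by blast
    then have "infinite ?A \<or> infinite ?B" using Y(1) by (metis finite_UnI)
    then have "I (?A, w, a) \<or> I (?B, w, b)"
      using w a b Y(2) by (auto simp: I_def)
    then show ?thesis using a b(1) by blast
  qed
  have "\<exists>f. \<forall>n. I (f n) \<and> (fst (f (Suc n)) \<subseteq> fst (f n) \<and> snd (snd (f (Suc n))) \<in> fst (f n))"
  proof (rule dependent_nat_choice)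
    show "\<exists>x. I x" using step[OF X order_refl] by blast
    show "\<exists>y. I y \<and> fst y \<subseteq> fst x \<and> snd (snd y) \<in> fst x" if "I x" for x n
      using step[of "fst x"] that by (fastforce simp: I_def split: prod.splits)
  qed
  then obtain f where f: "\<And>n. I (f n)" "\<And>n. fst (f (Suc n)) \<subseteq> fst (f n)"
    "\<And>n. snd (snd (f (Suc n))) \<in> fst (f n)" by blast
  define w x where "w n = fst (snd (f n))" and "x n = snd (snd (f n))" for n
  have wx: "w n \<in> W" "x n \<in> X" and sp: "z \<in> fst (f n) \<Longrightarrow> R (w n) z \<noteq> R (w n) (x n)" for n z
    using f(1)[of n] by (auto simp: I_def w_def x_def split: prod.splits)
  have "x m \<in> fst (f n)" if "n < m" for n m
    using that
  proof (cases m)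
    case (Suc k)
    then have "fst (f k) \<subseteq> fst (f n)"
      using lift_Suc_antimono_le[of "\<lambda>n. fst (f n)"] f(2) that by simp
    then show ?thesis using f(3)[of k] Suc by (auto simp: x_def)
  qed simp
  then have S: "R (w n) (x m) \<noteq> R (w n) (x n)" if "n < m" for n m
    using sp that by blast
  obtain h :: "nat \<Rightarrow> nat" and t where h: "strict_mono h" and t: "\<forall>i j. i < j \<longrightarrow>
      (R (w (h i)) (x (h i)), R (w (h i)) (x (h j)), R (w (h j)) (x (h i))) = t"
    using ramsey_sequence[of "\<lambda>i j. (R (w i) (x i), R (w i) (x j), R (w j) (x i))"] by blast
  obtain p q s where "t = (p, q, s)" by (cases t)
  with t have c: "R (w (h i)) (x (h i)) = p" "R (w (h i)) (x (h j)) = q"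
    "R (w (h j)) (x (h i)) = s" if "i < j" for i j
    using that by auto
  have "p \<noteq> q" using S[of "h 0" "h 1"] c[of 0 1] h by (auto simp: strict_mono_less)
  then obtain h' k' where "regular_pattern (\<lambda>i j. R (w (h (h' i))) (x (h (k' j))))"
    using regular_pattern_of_constant[of "\<lambda>i j. R (w (h i)) (x (h j))" p q s] c(2,3) c(1)[OF lessI]
    by blast
  then show ?thesis using wx by (intro exI[of _ "\<lambda>i. w (h (h' i))"] exI[of _ "\<lambda>i. x (h (k' i))"]) auto
qed

section \<open>Induced rays in locally finite graphs\<close>

text \<open>Koenig's lemma: if a vertex reaches infinitely many vertices, so does one of its
  finitely many successors.\<close>

lemma ray_of_finitely_branching:
  assumes fin: "\<And>x. (v, x) \<in> F\<^sup>* \<Longrightarrow> finite (F `` {x})" and inf: "infinite (F\<^sup>* `` {v})"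
  shows "\<exists>p. p 0 = v \<and> (\<forall>n::nat. (p n, p (Suc n)) \<in> F)"
proof -
  let ?P = "\<lambda>x. (v, x) \<in> F\<^sup>* \<and> infinite (F\<^sup>* `` {x})"
  have "\<exists>p. \<forall>n::nat. (?P (p n) \<and> (n = 0 \<longrightarrow> p n = v)) \<and> (p n, p (Suc n)) \<in> F"
  proof (rule dependent_nat_choice)
    fix x and n :: nat assume "?P x \<and> (n = 0 \<longrightarrow> x = v)"
    then have x: "(v, x) \<in> F\<^sup>*" "infinite (F\<^sup>* `` {x})" by auto
    have "F\<^sup>* `` {x} \<subseteq> insert x (\<Union>y \<in> F `` {x}. F\<^sup>* `` {y})"
      by (auto elim: converse_rtranclE)
    then have "infinite (\<Union>y \<in> F `` {x}. F\<^sup>* `` {y})"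
      using x(2) finite_subset by fastforce
    then obtain y where "(x, y) \<in> F" "infinite (F\<^sup>* `` {y})"
      using fin[OF x(1)] by auto
    then show "\<exists>y. (?P y \<and> (Suc n = 0 \<longrightarrow> y = v)) \<and> (x, y) \<in> F"
      using x(1) by (auto intro: rtrancl.rtrancl_into_rtrancl)
  qed (use inf in auto)
  then show ?thesis by blast
qed

text \<open>The path is a geodesic ray: its \<open>n\<close>-th vertex has distance \<open>n\<close>
  from \<open>v\<close>, and an edge raises this distance by at most one.\<close>

lemma induced_path_of_locally_finite:
  assumes "sym E" and fin: "\<And>x. finite (E `` {x})" and inf: "infinite (E\<^sup>* `` {v})"
  shows "\<exists>p. inj p \<and> (\<forall>n::nat. (v, p n) \<in> E\<^sup>*) \<and>
    (\<forall>i j. (p i, p j) \<in> E \<and> i < j \<longrightarrow> j = Suc i) \<and> (\<forall>n. (p n, p (Suc n)) \<in> E)"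
proof -
  define d where "d x = (LEAST n. (v, x) \<in> E ^^ n)" for x
  have d: "(v, x) \<in> E ^^ d x" if "(v, x) \<in> E\<^sup>*" for x
    unfolding d_def using that by (metis LeastI rtrancl_power)
  have d_le: "d x \<le> n" if "(v, x) \<in> E ^^ n" for x n
    unfolding d_def using that by (rule Least_le)
  \<comment> \<open>Arcs of \<open>F\<close> lead one step further away from \<open>v\<close>, so
    rays in \<open>F\<close> from \<open>v\<close> are geodesic. Shortest paths run inside
    \<open>F\<close>, hence \<open>F\<close> reaches all that \<open>E\<close> reaches from
    \<open>v\<close>.\<close>
  define F where "F = {(x, y). (x, y) \<in> E \<and> d y = Suc (d x)}"
  have FE: "F\<^sup>* \<subseteq> E\<^sup>*" by (rule rtrancl_mono) (auto simp: F_def)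
  have "(v, x) \<in> F\<^sup>*" if "(v, x) \<in> E\<^sup>*" "d x = n" for x n
    using that
  proof (induction n arbitrary: x)
    case 0
    then show ?case using d[of x] by simp
  next
    case (Suc n)
    then obtain y where y: "(v, y) \<in> E ^^ n" "(y, x) \<in> E"
      using d[of x] by auto
    then have vy: "(v, y) \<in> E\<^sup>*" by (metis relpow_imp_rtrancl)
    have "Suc n \<le> Suc (d y)"
      using d_le[of x "Suc (d y)"] d[OF vy] y(2) Suc.prems(2) by auto
    then have "d y = n" using d_le[OF y(1)] by simp
    then show ?case
      using Suc.IH[OF vy] y(2) Suc.prems(2) by (auto simp: F_def intro: rtrancl.rtrancl_into_rtrancl)
  qed
  then have "E\<^sup>* `` {v} \<subseteq> F\<^sup>* `` {v}" by blast
  then have "infinite (F\<^sup>* `` {v})" using inf infinite_super by blast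
  moreover have "finite (F `` {x})" for x
    using fin[of x] by (rule finite_subset[rotated]) (auto simp: F_def)
  ultimately obtain p where p: "p 0 = v" "\<And>n. (p n, p (Suc n)) \<in> F"
    using ray_of_finitely_branching[of v F] by blast
  have E: "(p n, p (Suc n)) \<in> E" for n using p(2) by (auto simp: F_def)
  have vp: "(v, p n) \<in> E\<^sup>*" for n
    by (induction n) (use p(1) E in \<open>auto intro: rtrancl.rtrancl_into_rtrancl\<close>)
  have dp: "d (p n) = n" for n
  proof (induction n)
    case 0
    then show ?case using d_le[of v 0] p(1) by simp
  next
    case (Suc n)
    then show ?case using p(2)[of n] by (auto simp: F_def)
  qed
  have "inj p" by (metis dp injI)
  moreover have "j = Suc i" if "(p i, p j) \<in> E" "i < j" for i j
  proof -
    have "(v, p i) \<in> E ^^ i" using d[OF vp, of i] by (simp add: dp)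
    then have "(v, p j) \<in> E ^^ Suc i" using that(1) by auto
    from d_le[OF this] that(2) show ?thesis by (simp add: dp)
  qed
  ultimately show ?thesis using vp E by blast
qed

section \<open>Two-level configurations and duality\<close>

text \<open>Distinctness of the points is implicit in the patterns used;
  \<open>two_level_distinct\<close> recovers it.\<close>

definition two_level :: "'a set \<Rightarrow> ('a \<Rightarrow> 'a \<Rightarrow> bool) \<Rightarrow> (nat \<Rightarrow> nat \<Rightarrow> bool) \<Rightarrow>
    (nat \<Rightarrow> 'a) \<Rightarrow> (nat \<Rightarrow> 'a) \<Rightarrow> bool" where
  "two_level V lt S a b \<longleftrightarrow> (\<forall>i. a i \<in> V \<and> b i \<in> V) \<and>
     (\<forall>i j. \<not> lt (a i) (a j) \<and> \<not> lt (b i) (b j) \<and> \<not> lt (b i) (a j) \<and> lt (a i) (b j) = S i j)"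

text \<open>In order, these are copies of \<open>Q0\<close>, \<open>Q1\<close>, the dual of
  \<open>Q1\<close>, \<open>Q2\<close>, and then of \<open>Q3\<close> (with \<open>c\<close> below
  the upper level) or its dual (with \<open>c\<close> above the lower level).\<close>

definition unavoidable :: "'a set \<Rightarrow> ('a \<Rightarrow> 'a \<Rightarrow> bool) \<Rightarrow> bool" where
  "unavoidable V lt \<longleftrightarrow> (\<exists>a b. two_level V lt (\<noteq>) a b \<or> two_level V lt (\<le>) a b \<or>
     two_level V lt (\<ge>) a b \<or> two_level V lt (\<lambda>i j. j = i \<or> j = i + 1) a b \<or>
     two_level V lt (=) a b \<and> (\<exists>c\<in>V.
       (\<forall>i. lt c (b i) \<and> \<not> lt (b i) c \<and> \<not> lt c (a i) \<and> \<not> lt (a i) c) \<or>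
       (\<forall>i. lt (a i) c \<and> \<not> lt c (a i) \<and> \<not> lt c (b i) \<and> \<not> lt (b i) c)))"

text \<open>Exchanging the levels transposes the pattern. This swaps \<open>(\<le>)\<close> with
  \<open>(\<ge>)\<close> and the two positions of \<open>c\<close>, and fixes
  \<open>(\<noteq>)\<close> and \<open>(=)\<close>.\<close>

lemma unavoidable_dual:
  assumes "unavoidable V (\<lambda>x y. lt y x)"
  shows "unavoidable V lt"
proof -
  have sw: "two_level V lt S' b a" if "two_level V (\<lambda>x y. lt y x) S a b" "\<And>i j. S' i j = S j i"
    for S S' a b
    using that by (auto simp: two_level_def)
  \<comment> \<open>The transposed zigzag is \<open>i = j \<or> i = j + 1\<close>; dropping
    \<open>b 0\<close> shifts it back to the pattern of \<open>Q2\<close>.\<close>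
  have z: "two_level V lt (\<lambda>i j. j = i \<or> j = i + 1) (\<lambda>i. b (Suc i)) a"
    if "two_level V (\<lambda>x y. lt y x) (\<lambda>i j. j = i \<or> j = i + 1) a b" for a b
    using that by (auto simp: two_level_def)
  obtain a b where ab: "two_level V (\<lambda>x y. lt y x) (\<noteq>) a b \<or> two_level V (\<lambda>x y. lt y x) (\<le>) a b \<or>
     two_level V (\<lambda>x y. lt y x) (\<ge>) a b \<or>
     two_level V (\<lambda>x y. lt y x) (\<lambda>i j. j = i \<or> j = i + 1) a b \<or>
     two_level V (\<lambda>x y. lt y x) (=) a b \<and> (\<exists>c\<in>V.
       (\<forall>i. lt (b i) c \<and> \<not> lt c (b i) \<and> \<not> lt (a i) c \<and> \<not> lt c (a i)) \<or>
       (\<forall>i. lt c (a i) \<and> \<not> lt (a i) c \<and> \<not> lt (b i) c \<and> \<not> lt c (b i)))"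
    using assms unfolding unavoidable_def by blast
  then show ?thesis
  proof (elim disjE conjE)
    assume "two_level V (\<lambda>x y. lt y x) (\<noteq>) a b"
    then show ?thesis using sw[of "(\<noteq>)" a b "(\<noteq>)"] unfolding unavoidable_def by blast
  next
    assume "two_level V (\<lambda>x y. lt y x) (\<le>) a b"
    then show ?thesis using sw[of "(\<le>)" a b "(\<ge>)"] unfolding unavoidable_def by blast
  next
    assume "two_level V (\<lambda>x y. lt y x) (\<ge>) a b"
    then show ?thesis using sw[of "(\<ge>)" a b "(\<le>)"] unfolding unavoidable_def by blast
  next
    assume "two_level V (\<lambda>x y. lt y x) (\<lambda>i j. j = i \<or> j = i + 1) a b"
    then show ?thesis using z unfolding unavoidable_def by blast
  next
    assume "two_level V (\<lambda>x y. lt y x) (=) a b" and c: "\<exists>c\<in>V.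
       (\<forall>i. lt (b i) c \<and> \<not> lt c (b i) \<and> \<not> lt (a i) c \<and> \<not> lt c (a i)) \<or>
       (\<forall>i. lt c (a i) \<and> \<not> lt (a i) c \<and> \<not> lt (b i) c \<and> \<not> lt c (b i))"
    then have "two_level V lt (=) b a" using sw[of "(=)" a b "(=)"] by blast
    with c show ?thesis unfolding unavoidable_def by blast
  qed
qed


text \<open>
  An element \<open>w\<close> capped by \<open>y\<close> that lies above some points of \<open>I\<close> but not above others is
  incomparable to the latter, so that \<open>w\<close> and \<open>y\<close> can play the roles of \<open>b\<close> and \<open>c\<close> in the dual
  of \<open>Q3\<close> or \<open>w\<close> that of an upper element of \<open>Q0\<close> or \<open>Q1\<close>.
\<close>

definition capped :: "'a set \<Rightarrow> ('a \<Rightarrow> 'a \<Rightarrow> bool) \<Rightarrow> 'a set \<Rightarrow> 'a \<Rightarrow> 'a \<Rightarrow> bool" where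
  "capped V lt I y w \<longleftrightarrow> y \<in> V \<and> (\<forall>z\<in>I. lt z y \<and> \<not> lt w z) \<and> \<not> lt w y \<and> \<not> lt y w"

section \<open>Infinite prime orders without infinite chains\<close>

text \<open>With \<open>lt\<close> a predicate, the dual order arises by swapping arguments, and
  \<open>dual\<close> makes each result available upside down. Primality is put contrapositively
  because it serves to produce an outside element that distinguishes two points of
  \<open>A\<close>.\<close>

locale prime_order =
  fixes V :: "'a set" and lt :: "'a \<Rightarrow> 'a \<Rightarrow> bool"
  assumes irrefl: "\<not> lt x x"
    and trans: "lt x y \<Longrightarrow> lt y z \<Longrightarrow> lt x z"
    and infinite_V: "infinite V"
    and prime: "A \<subseteq> V \<Longrightarrow> x \<in> A \<Longrightarrow> y \<in> A \<Longrightarrow> x \<noteq> y \<Longrightarrow> A \<noteq> V \<Longrightarrow>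
      \<exists>v\<in>V - A. \<exists>a\<in>A. \<exists>b\<in>A. lt v a \<noteq> lt v b \<or> lt a v \<noteq> lt b v"
    and no_infinite_chain: "K \<subseteq> V \<Longrightarrow> infinite K \<Longrightarrow>
      \<exists>x\<in>K. \<exists>y\<in>K. x \<noteq> y \<and> \<not> lt x y \<and> \<not> lt y x"
begin

lemma asym: "lt x y \<Longrightarrow> \<not> lt y x"
  using irrefl trans by blast

lemma dual: "prime_order V (\<lambda>x y. lt y x)"
proof
  fix A x y assume "A \<subseteq> V" "x \<in> A" "y \<in> A" "x \<noteq> y" "A \<noteq> V"
  from prime[OF this] show "\<exists>v\<in>V - A. \<exists>a\<in>A. \<exists>b\<in>A. lt a v \<noteq> lt b v \<or> lt v a \<noteq> lt v b"
    by blast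
next
  fix K assume "K \<subseteq> V" "infinite K"
  from no_infinite_chain[OF this] show "\<exists>x\<in>K. \<exists>y\<in>K. x \<noteq> y \<and> \<not> lt y x \<and> \<not> lt x y"
    by blast
qed (use irrefl trans infinite_V in blast)+

lemma sequence_not_comparable:
  assumes "\<And>i::nat. f i \<in> V" "\<And>i j. i < j \<Longrightarrow> f i \<noteq> f j"
  shows "\<exists>i j. i < j \<and> \<not> lt (f i) (f j) \<and> \<not> lt (f j) (f i)"
proof -
  have "inj f" using assms(2) by (metis injI linorder_neqE_nat)
  then have "infinite (range f)" by (rule range_inj_infinite)
  then obtain i j where "f i \<noteq> f j" "\<not> lt (f i) (f j)" "\<not> lt (f j) (f i)"
    using no_infinite_chain[of "range f"] assms(1) by blast
  then show ?thesis by (cases i j rule: linorder_cases) auto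
qed

text \<open>Otherwise an ascending sequence would form an infinite chain.\<close>

lemma maximal_exists:
  assumes "A \<subseteq> V" "A \<noteq> {}"
  shows "\<exists>m\<in>A. \<forall>y\<in>A. \<not> lt m y"
proof (rule ccontr)
  assume neg: "\<not> ?thesis"
  have "\<exists>f. \<forall>n::nat. f n \<in> A \<and> lt (f n) (f (Suc n))"
    by (rule dependent_nat_choice) (use assms(2) neg in auto)
  then obtain f where f: "\<And>n::nat. f n \<in> A" "\<And>n. lt (f n) (f (Suc n))" by blast
  have lt: "lt (f i) (f j)" if "i < j" for i j
    using that by (induction j) (auto simp: less_Suc_eq intro: f trans)
  show False
    using sequence_not_comparable[of f] lt f(1) assms(1) irrefl by (metis subsetD)
qed

section \<open>Copies built from capped outer elements\<close>

text \<open>The \<open>u j\<close> form the lower level and a subsequence of the \<open>w i\<close>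
  the upper one; for the pattern \<open>(=)\<close>, the cap \<open>y\<close> above all
  \<open>u j\<close> completes the dual of \<open>Q3\<close>.\<close>

lemma unavoidable_of_capped_pattern:
  assumes pat: "regular_pattern (\<lambda>i j. lt (u j) (w i))"
    and uw: "\<And>i. u i \<in> V" "\<And>i. w i \<in> V" "\<And>i j. \<not> lt (w i) (u j)" "\<And>i j. \<not> lt (u i) (u j)"
    and y: "y \<in> V" "\<And>i. lt (u i) y" "\<And>i. \<not> lt (w i) y" "\<And>i. \<not> lt y (w i)"
  shows "unavoidable V lt"
proof -
  obtain h :: "nat \<Rightarrow> nat" and t where h: "strict_mono h" and t: "\<forall>i j. i < j \<longrightarrow>
      (lt (w (h i)) (w (h j)), lt (w (h j)) (w (h i))) = t"
    using ramsey_sequence[of "\<lambda>i j. (lt (w i) (w j), lt (w j) (w i))"] by blast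
  have "inj w" using regular_pattern_inj[of "\<lambda>w u. lt u w"] pat by blast
  then have "w (h i) \<noteq> w (h j)" if "i < j" for i j
    using that h by (simp add: inj_eq strict_mono_eq)
  then obtain i j where "i < j" "\<not> lt (w (h i)) (w (h j))" "\<not> lt (w (h j)) (w (h i))"
    using sequence_not_comparable[of "w \<circ> h"] uw(2) by auto
  \<comment> \<open>The homogeneous sequence contains an incomparable pair, so it is an
    antichain.\<close>
  then have "t = (False, False)" using t by auto
  then have ww: "\<not> lt (w (h i)) (w (h j))" for i j
    using t irrefl by (cases i j rule: linorder_cases) auto
  let ?a = "\<lambda>i. u (h i)" and ?b = "\<lambda>i. w (h i)"
  \<comment> \<open>Rows of the given pattern belong to \<open>w\<close>, rows of
    \<open>two_level\<close> to \<open>u\<close>, so cases 3 and 4 below exchange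
    \<open>(\<le>)\<close> and \<open>(\<ge>)\<close>.\<close>
  have two: "two_level V lt S ?a ?b" if "\<And>i j. lt (u (h j)) (w (h i)) = S j i" for S
    using that uw ww by (auto simp: two_level_def)
  have "regular_pattern (\<lambda>i j. lt (u (h j)) (w (h i)))"
    using regular_pattern_strict_mono[OF pat h] .
  then consider "\<And>i j. lt (u (h j)) (w (h i)) = (i = j)" | "\<And>i j. lt (u (h j)) (w (h i)) = (i \<noteq> j)"
    | "\<And>i j. lt (u (h j)) (w (h i)) = (i \<le> j)" | "\<And>i j. lt (u (h j)) (w (h i)) = (j \<le> i)"
    unfolding regular_pattern_def by blast
  then show ?thesis
  proof cases
    case 1
    then have "two_level V lt (=) ?a ?b" by (intro two) auto
    moreover have "\<forall>i. lt (?a i) y \<and> \<not> lt y (?a i) \<and> \<not> lt y (?b i) \<and> \<not> lt (?b i) y"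
      using y asym by blast
    ultimately show ?thesis using y(1) unfolding unavoidable_def by blast
  next
    case 2
    then have "two_level V lt (\<noteq>) ?a ?b" by (intro two) auto
    then show ?thesis unfolding unavoidable_def by blast
  next
    case 3
    then have "two_level V lt (\<ge>) ?a ?b" by (intro two) auto
    then show ?thesis unfolding unavoidable_def by blast
  next
    case 4
    then have "two_level V lt (\<le>) ?a ?b" by (intro two) auto
    then show ?thesis unfolding unavoidable_def by blast
  qed
qed

text \<open>A capped \<open>w i\<close> is below no element of \<open>I\<close>, so comparability
  with \<open>u j\<close> can only mean \<open>lt (u j) (w i)\<close>.\<close>

lemma unavoidable_of_capped_sequence:
  assumes pat: "regular_pattern (\<lambda>i j. lt (u j) (w i) \<or> lt (w i) (u j))"
    and I: "I \<subseteq> V" "\<And>j. u j \<in> I" and w: "\<And>i. w i \<in> V" and u: "\<And>i j. \<not> lt (u i) (u j)"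
    and inf: "infinite {i. capped V lt I y (w i)}"
  shows "unavoidable V lt"
proof -
  obtain h :: "nat \<Rightarrow> nat" where h: "strict_mono h" "\<And>n. capped V lt I y (w (h n))"
    using infinite_enumerate[OF inf] by blast
  have "regular_pattern (\<lambda>i j. lt (u (h j)) (w (h i)) \<or> lt (w (h i)) (u (h j)))"
    using regular_pattern_strict_mono[OF pat h(1)] .
  moreover have "\<not> lt (w (h i)) (u j)" for i j using h(2)[of i] I(2) by (simp add: capped_def)
  ultimately show ?thesis
    using h(2) I w u
    by (intro unavoidable_of_capped_pattern[of "\<lambda>i. u (h i)" "\<lambda>i. w (h i)" y])
       (auto simp: capped_def)
qed

text \<open>One of the two kinds of cap occurs infinitely often, and the dual order turns the second
  kind into the first.\<close>

lemma unavoidable_of_pattern: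
  assumes pat: "regular_pattern (\<lambda>i j. lt (u j) (w i) \<or> lt (w i) (u j))"
    and I: "I \<subseteq> V" "\<And>j. u j \<in> I" and w: "\<And>i. w i \<in> V" and u: "\<And>i j. \<not> lt (u i) (u j)"
    and cap: "\<And>i. capped V lt I y (w i) \<or> capped V (\<lambda>x y. lt y x) I c (w i)"
  shows "unavoidable V lt"
proof -
  have "UNIV = {i. capped V lt I y (w i)} \<union> {i. capped V (\<lambda>x y. lt y x) I c (w i)}"
    using cap by auto
  then consider "infinite {i. capped V lt I y (w i)}"
    | "infinite {i. capped V (\<lambda>x y. lt y x) I c (w i)}"
    by (metis finite_UnI infinite_UNIV_nat)
  then show ?thesis
  proof cases
    case 1
    then show ?thesis using unavoidable_of_capped_sequence[OF pat I w u] by blast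
  next
    case 2
    have "regular_pattern (\<lambda>i j. lt (w i) (u j) \<or> lt (u j) (w i))"
      using pat by (simp add: disj_commute)
    from prime_order.unavoidable_of_capped_sequence[OF dual this I w u 2]
    show ?thesis by (rule unavoidable_dual)
  qed
qed

text \<open>If \<open>e' j\<close> were below \<open>e j\<close>, it would be below
  \<open>w\<close>. So each \<open>e j\<close> is below its \<open>e' j\<close>, and
  \<open>w\<close> above all \<open>e j\<close> completes the dual of \<open>Q3\<close>.\<close>

lemma unavoidable_of_spider:
  assumes I: "I \<subseteq> V" "\<And>j::nat. e j \<in> I" "\<And>j. e' j \<in> I" and w: "w \<in> V" "capped V lt I y w"
    and ew: "\<And>j. lt (e j) w" "\<And>j. \<not> lt (e' j) w"
    and adj: "\<And>j. lt (e j) (e' j) \<or> lt (e' j) (e j)"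
    and sep: "\<And>i j. i \<noteq> j \<Longrightarrow> \<not> lt (e i) (e j) \<and> \<not> lt (e i) (e' j) \<and>
      \<not> lt (e' i) (e j) \<and> \<not> lt (e' i) (e' j)"
  shows "unavoidable V lt"
proof -
  have ee: "lt (e j) (e' j)" for j using adj ew trans by blast
  have "two_level V lt (=) e e'"
    unfolding two_level_def using I ee sep irrefl asym by (metis subsetD)
  moreover have "\<forall>i. lt (e i) w \<and> \<not> lt w (e i) \<and> \<not> lt w (e' i) \<and> \<not> lt (e' i) w"
    using ew asym w(2) I(3) by (auto simp: capped_def)
  ultimately show ?thesis using w(1) unfolding unavoidable_def by blast
qed

section \<open>Zigzags from induced paths\<close>

text \<open>Two consecutive steps in the same direction would give a chord by transitivity, so the
  directions alternate.\<close>

lemma zigzag_of_induced_path: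
  assumes V: "\<And>n::nat. q n \<in> V" and adj: "\<And>n. lt (q n) (q (Suc n)) \<or> lt (q (Suc n)) (q n)"
    and ind: "\<And>i j. i < j \<Longrightarrow> lt (q i) (q j) \<or> lt (q j) (q i) \<Longrightarrow> j = Suc i"
    and q0: "lt (q 1) (q 0)"
  shows "unavoidable V lt"
proof -
  have alt: "lt (q n) (q (Suc n)) \<longleftrightarrow> lt (q (Suc (Suc n))) (q (Suc n))" for n
    using adj[of n] adj[of "Suc n"] trans asym ind[of n "Suc (Suc n)"] by (metis lessI less_SucI n_not_Suc_n)
  have "if even n then lt (q (Suc n)) (q n) else lt (q n) (q (Suc n))" for n
  proof (induction n)
    case 0
    then show ?case using q0 by simp
  next
    case (Suc n)
    then show ?case using alt[of n] adj[of n] adj[of "Suc n"] asym by (auto split: if_splits)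
  qed
  then have ev: "even n \<Longrightarrow> lt (q (Suc n)) (q n)" and od: "odd n \<Longrightarrow> lt (q n) (q (Suc n))" for n
    by metis+
  have "lt (q i) (q j) \<longleftrightarrow> odd i \<and> (j = Suc i \<or> i = Suc j)" for i j
  proof (cases i j rule: linorder_cases)
    case less
    then show ?thesis using ind[of i j] ev[of i] od[of i] asym by auto
  next
    case equal
    then show ?thesis using irrefl by simp
  next
    case greater
    then show ?thesis using ind[of j i] ev[of j] od[of j] asym by auto
  qed
  \<comment> \<open>Odd positions are the lower ones: \<open>q (2 * i + 1)\<close> has the
    neighbours \<open>q (2 * i)\<close> and \<open>q (2 * i + 2)\<close>.\<close>
  then have "two_level V lt (\<lambda>i j. j = i \<or> j = i + 1) (\<lambda>i. q (2 * i + 1)) (\<lambda>i. q (2 * i))"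
    using V by (simp add: two_level_def) presburger
  then show ?thesis unfolding unavoidable_def by blast
qed

lemma unavoidable_of_induced_path:
  assumes V: "\<And>n::nat. q n \<in> V" and adj: "\<And>n. lt (q n) (q (Suc n)) \<or> lt (q (Suc n)) (q n)"
    and ind: "\<And>i j. i < j \<Longrightarrow> lt (q i) (q j) \<or> lt (q j) (q i) \<Longrightarrow> j = Suc i"
  shows "unavoidable V lt"
proof (cases "lt (q 1) (q 0)")
  case True
  show ?thesis by (rule zigzag_of_induced_path[OF V adj ind True])
next
  case False
  then have lt: "lt (q 0) (q 1)" using adj[of 0] by simp
  have "lt (q (Suc n)) (q n) \<or> lt (q n) (q (Suc n))" for n using adj by blast
  from prime_order.zigzag_of_induced_path[OF dual V this _ lt] ind
  show ?thesis by (blast intro: unavoidable_dual)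
qed

section \<open>The components of a locally finite comparability graph\<close>

lemma unavoidable_of_locally_finite_subset:
  assumes I: "I \<subseteq> V" "infinite I"
    and fin: "\<And>x. x \<in> I \<Longrightarrow> finite {z \<in> I. lt x z \<or> lt z x}"
    and outer: "\<And>w. w \<in> V - I \<Longrightarrow> (\<forall>z\<in>I. lt w z) \<or> (\<forall>z\<in>I. lt z w) \<or>
      (\<forall>z\<in>I. \<not> lt w z \<and> \<not> lt z w) \<or> capped V lt I y w \<or> capped V (\<lambda>x y. lt y x) I c w"
  shows "unavoidable V lt"
proof -
  define cmp where "cmp x z \<longleftrightarrow> lt x z \<or> lt z x" for x z
  define cap where "cap w \<longleftrightarrow> capped V lt I y w \<or> capped V (\<lambda>x y. lt y x) I c w" for w
  define E where "E = {(x, z). x \<in> I \<and> z \<in> I \<and> cmp x z}"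
  have cmp_sym: "cmp x z = cmp z x" for x z by (auto simp: cmp_def)
  have symE: "sym E" by (auto simp: E_def sym_def cmp_def)
  have symE': "sym (E\<^sup>*)" by (rule sym_rtrancl[OF symE])
  have finE: "finite (E `` {x})" for x
  proof (cases "x \<in> I")
    case True
    have "E `` {x} \<subseteq> {z \<in> I. lt x z \<or> lt z x}" by (auto simp: E_def cmp_def)
    then show ?thesis using fin[OF True] finite_subset by blast
  qed (auto simp: E_def)
  have E_in: "z \<in> I" if "(x, z) \<in> E\<^sup>*" "x \<in> I" for x z
    using that by (induction) (auto simp: E_def)
  \<comment> \<open>The first three alternatives of \<open>outer\<close> describe elements related
    in the same way to all of \<open>I\<close>. A capped element is related to \<open>I\<close> in
    one direction only, so a difference in order is one in comparability.\<close>
  have mix: "cap w \<and> cmp w a \<noteq> cmp w b" if "w \<in> V - I" "a \<in> I" "b \<in> I"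
    "lt w a \<noteq> lt w b \<or> lt a w \<noteq> lt b w" for w a b
    using outer[OF that(1)] that(2-4) asym unfolding cap_def cmp_def capped_def by metis
  show ?thesis
  proof (cases "\<exists>v\<in>I. infinite (E\<^sup>* `` {v})")
    case True
    then obtain v where v: "v \<in> I" "infinite (E\<^sup>* `` {v})" by blast
    obtain p where p: "inj p" "\<forall>n::nat. (v, p n) \<in> E\<^sup>*"
      "\<forall>i j. (p i, p j) \<in> E \<and> i < j \<longrightarrow> j = Suc i" "\<forall>n. (p n, p (Suc n)) \<in> E"
      using induced_path_of_locally_finite[OF symE finE v(2)] by blast
    have pI: "p n \<in> I" for n using p(2) E_in v(1) by blast
    show ?thesis
    proof (rule unavoidable_of_induced_path[of p])
      show "p n \<in> V" for n using pI I(1) by blast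
      show "lt (p n) (p (Suc n)) \<or> lt (p (Suc n)) (p n)" for n
        using p(4) by (auto simp: E_def cmp_def)
      show "j = Suc i" if "i < j" "lt (p i) (p j) \<or> lt (p j) (p i)" for i j
        using p(3) pI that by (auto simp: E_def cmp_def)
    qed
  next
    case False
    then have fincomp: "finite (E\<^sup>* `` {v})" if "v \<in> I" for v using that by blast
    \<comment> \<open>\<open>X\<close> collects the isolated vertices of the comparability
      graph.\<close>
    define X where "X = {x \<in> I. \<forall>z\<in>I. \<not> cmp x z}"
    show ?thesis
    proof (cases "finite X")
      case False
      \<comment> \<open>Primality is applied to \<open>{a, b}\<close>. The separating element lies
        outside \<open>I\<close>, where \<open>a\<close> and \<open>b\<close> are isolated.\<close>
      have "\<exists>w\<in>{w \<in> V. cap w}. cmp w a \<noteq> cmp w b" if ab: "a \<in> X" "b \<in> X" "a \<noteq> b" for a b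
      proof -
        have abI: "a \<in> I" "b \<in> I" using ab by (auto simp: X_def)
        then obtain w where w: "w \<in> V - {a, b}" "lt w a \<noteq> lt w b \<or> lt a w \<noteq> lt b w"
          using prime[of "{a, b}" a b] ab(3) I(1) infinite_V by (auto; blast)
        then have "w \<notin> I" using ab(1,2) by (auto simp: X_def cmp_def)
        then show ?thesis using mix[of w a b] w abI by blast
      qed
      from regular_pattern_of_separation[where R = cmp, OF False this]
      obtain w x where wx: "\<forall>n::nat. w n \<in> {w \<in> V. cap w}" "\<forall>n::nat. x n \<in> X"
        "regular_pattern (\<lambda>i j. cmp (w i) (x j))" by blast
      have pat: "regular_pattern (\<lambda>i j. lt (x j) (w i) \<or> lt (w i) (x j))"
        using wx(3) by (simp add: cmp_def disj_commute)
      show ?thesis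
        by (rule unavoidable_of_pattern[OF pat I(1)]) (use wx(1,2) in \<open>auto simp: cap_def X_def cmp_def\<close>)
    next
      case True
      \<comment> \<open>Primality is applied to the component of \<open>x\<close>. An element of
        \<open>I\<close> comparable to one of its points would belong to it, so the separating
        \<open>w\<close> is outer. Along a path from \<open>a\<close> to \<open>b\<close>,
        comparability with \<open>w\<close> changes across some edge.\<close>
      have edge: "\<exists>w d d'. (x, d) \<in> E\<^sup>* \<and> (d, d') \<in> E \<and> w \<in> V \<and> cap w \<and> cmp w d \<noteq> cmp w d'"
        if x: "x \<in> I - X" for x
      proof -
        let ?C = "E\<^sup>* `` {x}"
        obtain z where z: "z \<in> I" "cmp x z" using x by (auto simp: X_def)
        then have "z \<in> ?C" "z \<noteq> x" using x irrefl by (auto simp: E_def cmp_def)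
        moreover have "?C \<subseteq> I" using x E_in by blast
        moreover have "?C \<noteq> V" using fincomp[of x] x infinite_V by auto
        ultimately obtain w a b where w: "w \<in> V - ?C" "a \<in> ?C" "b \<in> ?C"
          "lt w a \<noteq> lt w b \<or> lt a w \<noteq> lt b w"
          using prime[of ?C z x] I(1) by blast
        have abI: "a \<in> I" "b \<in> I" using w \<open>?C \<subseteq> I\<close> by auto
        have "w \<notin> I"
        proof
          assume "w \<in> I"
          then have "(a, w) \<in> E \<or> (b, w) \<in> E" using w(4) abI by (auto simp: E_def cmp_def)
          then show False using w(1-3) by (auto intro: rtrancl.rtrancl_into_rtrancl)
        qed
        then have m: "cap w" "cmp w a \<noteq> cmp w b" using mix[of w a b] w abI by auto
        have "(a, b) \<in> E\<^sup>*" using w(2,3) symE' by (meson Image_singleton_iff rtrancl_trans symD)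
        then have "\<exists>d d'. (x, d) \<in> E\<^sup>* \<and> (d, d') \<in> E \<and> cmp w d \<noteq> cmp w d'"
          using m(2)
        proof (induction rule: rtrancl_induct)
          case (step b b')
          have "(x, b) \<in> E\<^sup>*" using w(2) step.hyps(1) by auto
          then show ?case using step by blast
        qed simp
        then show ?thesis using m(1) w(1) by blast
      qed
      let ?K = "(\<lambda>x. E\<^sup>* `` {x}) ` (I - X)"
      \<comment> \<open>Finitely many finite components cannot cover the infinite set
        \<open>I - X\<close>.\<close>
      have "infinite ?K"
      proof
        assume "finite ?K"
        then have "finite (\<Union>?K)" using fincomp by auto
        moreover have "I - X \<subseteq> \<Union>?K" by auto
        ultimately show False using I(2) True finite_subset by (metis Diff_infinite_finite)
      qed
      then obtain C :: "nat \<Rightarrow> 'a set" where C: "inj C" "range C \<subseteq> ?K"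
        using infinite_countable_subset by blast
      have "\<forall>n. \<exists>w d d'. C n = E\<^sup>* `` {d} \<and> (d, d') \<in> E \<and> w \<in> V \<and> cap w \<and> cmp w d \<noteq> cmp w d'"
      proof
        fix n
        obtain x where x: "x \<in> I - X" "C n = E\<^sup>* `` {x}" using C(2) by blast
        obtain w d d' where w: "(x, d) \<in> E\<^sup>*" "(d, d') \<in> E" "w \<in> V" "cap w" "cmp w d \<noteq> cmp w d'"
          using edge[OF x(1)] by blast
        have "(d, x) \<in> E\<^sup>*" using w(1) symE' by (metis symD)
        then have "E\<^sup>* `` {d} = E\<^sup>* `` {x}" using w(1) by (auto intro: rtrancl_trans)
        then show "\<exists>w d d'. C n = E\<^sup>* `` {d} \<and> (d, d') \<in> E \<and> w \<in> V \<and> cap w \<and> cmp w d \<noteq> cmp w d'"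
          using x(2) w by auto
      qed
      then obtain w d d' where wd: "\<And>n. C n = E\<^sup>* `` {d n}" "\<And>n. (d n, d' n) \<in> E" "\<And>n. w n \<in> V"
        "\<And>n. cap (w n)" "\<And>n. cmp (w n) (d n) \<noteq> cmp (w n) (d' n)" by metis
      have dI: "d n \<in> I" "d' n \<in> I" and dd: "cmp (d n) (d' n)" for n
        using wd(2)[of n] by (auto simp: E_def)
      have sep: "\<not> cmp a b" if "a \<in> {d i, d' i}" "b \<in> {d j, d' j}" "i \<noteq> j" for a b i j
      proof
        assume "cmp a b"
        moreover have "a \<in> I" "b \<in> I" using that dI by auto
        ultimately have "(a, b) \<in> E" by (simp add: E_def)
        moreover have "(d i, a) \<in> E\<^sup>*" "(d j, b) \<in> E\<^sup>*" using that wd(2) by auto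
        moreover have "(b, d j) \<in> E\<^sup>*" using \<open>(d j, b) \<in> E\<^sup>*\<close> symE' by (metis symD)
        ultimately have ij: "(d i, d j) \<in> E\<^sup>*"
          by (meson rtrancl.rtrancl_into_rtrancl rtrancl_trans)
        then have "(d j, d i) \<in> E\<^sup>*" using symE' by (metis symD)
        with ij have "C i = C j" unfolding wd(1) by (auto intro: rtrancl_trans)
        then show False using C(1) that(3) by (simp add: inj_eq)
      qed
      have anti: "\<not> lt (d i) (d j)" "\<not> lt (d' i) (d' j)" for i j
        using sep[of "d i" i "d j" j] sep[of "d' i" i "d' j" j] irrefl
        by (cases "i = j"; auto simp: cmp_def)+
      \<comment> \<open>Either one outer element splits infinitely many of the chosen edges, or the
        outer elements form a regular pattern with one of the two sequences of endpoints.\<close>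
      from regular_pattern_of_separating_pairs[of "\<lambda>i j. cmp (w i) (d j)" "\<lambda>i j. cmp (w i) (d' j)", OF wd(5)]
      consider i and k :: "nat \<Rightarrow> nat" where "strict_mono k" "\<And>j. cmp (w i) (d (k j)) \<noteq> cmp (w i) (d' (k j))"
        | h k where "regular_pattern (\<lambda>i j. cmp (w (h i)) (d (k j)))"
        | h k where "regular_pattern (\<lambda>i j. cmp (w (h i)) (d' (k j)))"
        by blast
      then show ?thesis
      proof cases
        case 1
        \<comment> \<open>Which end of an edge is comparable to \<open>w i\<close> may vary with
          \<open>j\<close>; \<open>e j\<close> is that end and \<open>e' j\<close> the
          other.\<close>
        define e where "e j = (if cmp (w i) (d (k j)) then d (k j) else d' (k j))" for j
        define e' where "e' j = (if cmp (w i) (d (k j)) then d' (k j) else d (k j))" for j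
        have ew: "cmp (w i) (e j)" "\<not> cmp (w i) (e' j)" for j
          using 1(2)[of j] by (auto simp: e_def e'_def)
        have eI: "e j \<in> I" "e' j \<in> I" and adj: "cmp (e j) (e' j)" for j
          using dI dd cmp_sym by (auto simp: e_def e'_def)
        have ek: "e j \<in> {d (k j), d' (k j)}" "e' j \<in> {d (k j), d' (k j)}" for j
          by (auto simp: e_def e'_def)
        have es: "\<not> cmp (e a) (e b) \<and> \<not> cmp (e a) (e' b) \<and> \<not> cmp (e' a) (e b) \<and> \<not> cmp (e' a) (e' b)"
          if "a \<noteq> b" for a b
        proof -
          have "k a \<noteq> k b" using 1(1) that by (simp add: strict_mono_eq)
          then show ?thesis using sep ek by blast
        qed
        consider "capped V lt I y (w i)" | "capped V (\<lambda>x y. lt y x) I c (w i)"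
          using wd(4) cap_def by blast
        then show ?thesis
        proof cases
          case 1
          then show ?thesis
            using ew eI adj es wd(3)
            by (intro unavoidable_of_spider[of I e e' "w i" y, OF I(1)])
               (auto simp: cmp_def capped_def)
        next
          case 2
          have adj': "lt (e' j) (e j) \<or> lt (e j) (e' j)" for j
            using adj by (auto simp: cmp_def)
          from 2 have "unavoidable V (\<lambda>x y. lt y x)"
            using ew eI adj' es wd(3)
            by (intro prime_order.unavoidable_of_spider[OF dual, of I e e' "w i" c, OF I(1)])
               (auto simp: cmp_def capped_def)
          then show ?thesis by (rule unavoidable_dual)
        qed
      next
        case 2
        then have pat: "regular_pattern (\<lambda>i j. lt (d (k j)) (w (h i)) \<or> lt (w (h i)) (d (k j)))"
          by (simp add: cmp_def disj_commute)
        show ?thesis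
          by (rule unavoidable_of_pattern[OF pat I(1)]) (use wd(3,4) dI anti in \<open>auto simp: cap_def\<close>)
      next
        case 3
        then have pat: "regular_pattern (\<lambda>i j. lt (d' (k j)) (w (h i)) \<or> lt (w (h i)) (d' (k j)))"
          by (simp add: cmp_def disj_commute)
        show ?thesis
          by (rule unavoidable_of_pattern[OF pat I(1)]) (use wd(3,4) dI anti in \<open>auto simp: cap_def\<close>)
      qed
    qed
  qed
qed

section \<open>The choice of the locally finite subset\<close>

lemma unavoidable_of_infinite_up_set:
  assumes "x \<in> V" "infinite {z \<in> V. lt x z}"
  shows "unavoidable V lt"
proof -
  \<comment> \<open>Maximality of \<open>c\<close> makes the up-set of every element above
    \<open>c\<close> finite, so only down-sets can spoil local finiteness.\<close>
  obtain c where c: "c \<in> V" "infinite {z \<in> V. lt c z}"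
    and max: "\<And>z. z \<in> V \<Longrightarrow> lt c z \<Longrightarrow> finite {u \<in> V. lt z u}"
    using maximal_exists[of "{x \<in> V. infinite {z \<in> V. lt x z}}"] assms by auto
  let ?U = "{z \<in> V. lt c z}"
  have up: "finite {u \<in> I. lt z u}" if "z \<in> ?U" "I \<subseteq> V" for z I
    using max[of z] that by (auto intro: finite_subset[rotated])
  have below: "w = c \<or> lt w c \<or> lt c w \<or> capped V (\<lambda>x y. lt y x) I c w" if "w \<in> V" "I \<subseteq> ?U" for w I
    using that c(1) trans by (auto simp: capped_def)
  show ?thesis
  proof (cases "\<exists>y\<in>?U. infinite {z \<in> ?U. lt z y}")
    case False
    have "finite {z \<in> ?U. lt x z \<or> lt z x}" if "x \<in> ?U" for x
    proof -
      have "{z \<in> ?U. lt x z \<or> lt z x} = {z \<in> ?U. lt x z} \<union> {z \<in> ?U. lt z x}" by auto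
      moreover have "finite {z \<in> ?U. lt x z}" using up[OF that, of ?U] by blast
      moreover have "finite {z \<in> ?U. lt z x}" using False that by blast
      ultimately show ?thesis by simp
    qed
    moreover have "(\<forall>z\<in>?U. lt w z) \<or> capped V (\<lambda>x y. lt y x) ?U c w" if "w \<in> V - ?U" for w
      using below[of w ?U] that trans by auto
    \<comment> \<open>Outer elements are capped only through \<open>c\<close> here; the first
      \<open>c\<close> in the instantiation merely fills the place of \<open>y\<close>.\<close>
    ultimately show ?thesis
      using unavoidable_of_locally_finite_subset[of ?U c c] c(2) by blast
  next
    case True
    \<comment> \<open>A maximal element in the dual order: by minimality of \<open>y\<close>,
      elements between \<open>c\<close> and \<open>y\<close> have only finitely many elements of
      \<open>?U\<close> below them.\<close>
    then obtain y where y: "y \<in> ?U" "infinite {z \<in> ?U. lt z y}"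
      and min: "\<And>z. z \<in> ?U \<Longrightarrow> lt z y \<Longrightarrow> finite {u \<in> ?U. lt u z}"
      using prime_order.maximal_exists[OF dual, of "{y \<in> ?U. infinite {z \<in> ?U. lt z y}}"] by auto
    let ?I = "{z \<in> ?U. lt z y}"
    have "finite {z \<in> ?I. lt x z \<or> lt z x}" if "x \<in> ?I" for x
    proof -
      have "{z \<in> ?I. lt x z \<or> lt z x} = {z \<in> ?I. lt x z} \<union> {z \<in> ?I. lt z x}" by auto
      moreover have "finite {z \<in> ?I. lt x z}" using up[of x ?I] that by auto
      moreover have "finite {z \<in> ?I. lt z x}"
        using min[of x] that by (auto intro: finite_subset[rotated])
      ultimately show ?thesis by simp
    qed
    moreover have "(\<forall>z\<in>?I. lt w z) \<or> (\<forall>z\<in>?I. lt z w) \<or> capped V lt ?I y w \<or>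
        capped V (\<lambda>x y. lt y x) ?I c w" if w: "w \<in> V - ?I" for w
    proof -
      consider "w = c \<or> lt w c" | "capped V (\<lambda>x y. lt y x) ?I c w" | "lt c w" "w = y \<or> lt y w"
        | "\<not> lt w y" "\<not> lt y w"
        using below[of w ?I] w by auto
      then show ?thesis
      proof cases
        case 1
        then show ?thesis using trans by auto
      next
        case 3
        then show ?thesis using trans by auto
      next
        case 4
        then have "capped V lt ?I y w" using y(1) trans by (auto simp: capped_def)
        then show ?thesis by blast
      qed blast
    qed
    ultimately show ?thesis
      using unavoidable_of_locally_finite_subset[of ?I y c] y(2) by blast
  qed
qed

lemma unavoidable_prime_order: "unavoidable V lt"
proof (cases "\<exists>x\<in>V. infinite {z \<in> V. lt x z} \<or> infinite {z \<in> V. lt z x}")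
  case True
  then show ?thesis
    using unavoidable_of_infinite_up_set prime_order.unavoidable_of_infinite_up_set[OF dual]
      unavoidable_dual by blast
next
  case False
  have "finite {z \<in> V. lt x z \<or> lt z x}" if "x \<in> V" for x
  proof -
    have "{z \<in> V. lt x z \<or> lt z x} = {z \<in> V. lt x z} \<union> {z \<in> V. lt z x}" by auto
    then show ?thesis using False that by simp
  qed
  \<comment> \<open>With \<open>I = V\<close> there are no outer elements, so any values serve as
    caps.\<close>
  then show ?thesis
    using unavoidable_of_locally_finite_subset[of V undefined undefined] infinite_V by blast
qed

end

section \<open>From order relations to configurations and back to embeddings\<close>

lemma prime_poset_prime_order:
  assumes "prime_poset V r" "infinite V" "\<not> (\<exists>K\<in>Chains r. infinite K)"
  shows "prime_order V (\<lambda>x y. (x, y) \<in> r - Id)"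
proof
  have po: "antisym r" "trans r" "refl_on V r"
    using assms(1) by (auto simp: prime_poset_def partial_order_on_def preorder_on_def)
  show "(x, z) \<in> r - Id" if "(x, y) \<in> r - Id" "(y, z) \<in> r - Id" for x y z
    using that po(1,2) by (auto dest: transD antisymD)
  show "\<exists>v\<in>V - A. \<exists>a\<in>A. \<exists>b\<in>A. ((v, a) \<in> r - Id) \<noteq> ((v, b) \<in> r - Id) \<or>
      ((a, v) \<in> r - Id) \<noteq> ((b, v) \<in> r - Id)"
    if A: "A \<subseteq> V" "x \<in> A" "y \<in> A" "x \<noteq> y" "A \<noteq> V" for A x y
  proof -
    have "\<not> autonomous V r A" using assms(1) A unfolding prime_poset_def by blast
    then show ?thesis using A(1) unfolding autonomous_def by blast
  qed
  show "\<exists>x\<in>K. \<exists>y\<in>K. x \<noteq> y \<and> (x, y) \<notin> r - Id \<and> (y, x) \<notin> r - Id"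
    if K: "K \<subseteq> V" "infinite K" for K
  proof -
    have "K \<notin> Chains r" using assms(3) K(2) by blast
    then obtain x y where "x \<in> K" "y \<in> K" "(x, y) \<notin> r" "(y, x) \<notin> r"
      unfolding Chains_def by blast
    \<comment> \<open>Reflexivity on \<open>V\<close> forces the two incomparable points to be
      distinct.\<close>
    then show ?thesis using po(3) K(1) by (metis DiffD1 refl_onD subsetD)
  qed
qed (use assms(2) in auto)

lemma embeds_posetI:
  assumes r: "refl_on V r" "refl_on W s" and f: "\<And>x. x \<in> W \<Longrightarrow> f x \<in> V"
    and inj: "inj_on f W"
    and ord: "\<And>x y. x \<in> W \<Longrightarrow> y \<in> W \<Longrightarrow> x \<noteq> y \<Longrightarrow> (x, y) \<in> s \<longleftrightarrow> (f x, f y) \<in> r - Id"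
  shows "embeds_poset V r W s"
proof -
  have "(x, y) \<in> s \<longleftrightarrow> (f x, f y) \<in> r \<inter> f ` W \<times> f ` W" if "x \<in> W" "y \<in> W" for x y
  proof (cases "x = y")
    case True
    then show ?thesis using that r f by (auto dest: refl_onD)
  next
    case False
    then have "f x \<noteq> f y" using inj that by (auto dest: inj_onD)
    then show ?thesis using ord[OF that False] that by auto
  qed
  then have "isomorphic_posets W s (f ` W) (r \<inter> f ` W \<times> f ` W)"
    unfolding isomorphic_posets_def using inj by (auto simp: bij_betw_def)
  then show ?thesis unfolding embeds_poset_def using f by blast
qed

text \<open>Points of one level are told apart by their rows or columns. Each \<open>a i\<close> is
  below some \<open>b k\<close>, while no \<open>b j\<close> is. The alternative
  \<open>S i (Suc i)\<close> serves \<open>(\<noteq>)\<close>, whose diagonal is empty.\<close>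

lemma two_level_distinct:
  assumes two: "two_level V lt S a b"
    and rows: "\<And>i j. i \<noteq> j \<Longrightarrow> S i i \<noteq> S j i \<or> S i j \<noteq> S j j"
    and columns: "\<And>i j. i \<noteq> j \<Longrightarrow> S i i \<noteq> S i j \<or> S j i \<noteq> S j j"
    and nonempty: "\<And>i. S i i \<or> S i (Suc i)"
  shows "a i = a j \<longleftrightarrow> i = j" "b i = b j \<longleftrightarrow> i = j" "a i \<noteq> b j" "b j \<noteq> a i"
proof -
  have S: "S i k = lt (a i) (b k)" and bb: "\<not> lt (b i) (b k)" for i k
    using two by (simp_all add: two_level_def)
  show "a i = a j \<longleftrightarrow> i = j" using rows[of i j] unfolding S by metis
  show "b i = b j \<longleftrightarrow> i = j" using columns[of i j] unfolding S by metis
  show "a i \<noteq> b j" "b j \<noteq> a i" using nonempty[of i] bb[of j] by (auto simp: S)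
qed

lemma embeds_of_unavoidable:
  assumes po: "partial_order_on V r" and un: "unavoidable V (\<lambda>x y. (x, y) \<in> r - Id)"
  shows "\<exists>(W, s) \<in> Q_family. embeds_poset V r W s"
proof -
  let ?lt = "\<lambda>x y. (x, y) \<in> r - Id"
  have emb: "\<exists>(W, s) \<in> Q_family. embeds_poset V r W s"
    if W: "(W, s) \<in> Q_family" and f: "\<And>x. x \<in> W \<Longrightarrow> f x \<in> V" "inj_on f W"
      "\<And>x y. x \<in> W \<Longrightarrow> y \<in> W \<Longrightarrow> x \<noteq> y \<Longrightarrow> (x, y) \<in> s \<longleftrightarrow> ?lt (f x) (f y)" for W s f
  proof -
    have "refl_on V r" "refl_on W s"
      using po Q_family_partial_order[OF W] by (auto simp: partial_order_on_def preorder_on_def)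
    then show ?thesis using embeds_posetI f W by blast
  qed
  obtain a b where ab: "two_level V ?lt (\<noteq>) a b \<or> two_level V ?lt (\<le>) a b \<or>
     two_level V ?lt (\<ge>) a b \<or> two_level V ?lt (\<lambda>i j. j = i \<or> j = i + 1) a b \<or>
     two_level V ?lt (=) a b \<and> (\<exists>c\<in>V.
       (\<forall>i. ?lt c (b i) \<and> \<not> ?lt (b i) c \<and> \<not> ?lt c (a i) \<and> \<not> ?lt (a i) c) \<or>
       (\<forall>i. ?lt (a i) c \<and> \<not> ?lt c (a i) \<and> \<not> ?lt c (b i) \<and> \<not> ?lt (b i) c))"
    using un unfolding unavoidable_def by blast
  then consider "two_level V ?lt (\<noteq>) a b" | "two_level V ?lt (\<le>) a b" | "two_level V ?lt (\<ge>) a b"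
    | "two_level V ?lt (\<lambda>i j. j = i \<or> j = i + 1) a b"
    | c where "two_level V ?lt (=) a b" "c \<in> V"
       "\<And>i. ?lt c (b i)" "\<And>i. \<not> ?lt (b i) c" "\<And>i. \<not> ?lt c (a i)" "\<And>i. \<not> ?lt (a i) c"
    | c where "two_level V ?lt (=) a b" "c \<in> V"
       "\<And>i. ?lt (a i) c" "\<And>i. \<not> ?lt c (a i)" "\<And>i. \<not> ?lt c (b i)" "\<And>i. \<not> ?lt (b i) c"
    by blast
  then show ?thesis
  proof cases
    case 1
    have d: "a i = a j \<longleftrightarrow> i = j" "b i = b j \<longleftrightarrow> i = j" "a i \<noteq> b j" "b j \<noteq> a i" for i j
      by (rule two_level_distinct[OF 1]; auto)+
    show ?thesis
      \<comment> \<open>\<open>Qc\<close> is outside \<open>AB\<close>, so its image may be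
        \<open>undefined\<close>.\<close>
      by (rule emb[of AB Q0 "case_q_elem a b undefined"])
        (use 1 d in \<open>auto simp: Q_family_def AB_def Q0_def inj_on_def two_level_def\<close>)
  next
    case 2
    have d: "a i = a j \<longleftrightarrow> i = j" "b i = b j \<longleftrightarrow> i = j" "a i \<noteq> b j" "b j \<noteq> a i" for i j
      by (rule two_level_distinct[OF 2]; auto)+
    show ?thesis
      by (rule emb[of AB Q1 "case_q_elem a b undefined"])
        (use 2 d in \<open>auto simp: Q_family_def AB_def Q1_def inj_on_def two_level_def\<close>)
  next
    case 3
    have d: "a i = a j \<longleftrightarrow> i = j" "b i = b j \<longleftrightarrow> i = j" "a i \<noteq> b j" "b j \<noteq> a i" for i j
      by (rule two_level_distinct[OF 3]; auto)+
    show ?thesis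
      \<comment> \<open>In the dual the \<open>Qa i\<close> are the upper elements and hence go to
        \<open>b i\<close>.\<close>
      by (rule emb[of AB "Q1\<inverse>" "case_q_elem b a undefined"])
        (use 3 d in \<open>auto simp: Q_family_def AB_def Q1_def inj_on_def two_level_def\<close>)
  next
    case 4
    have d: "a i = a j \<longleftrightarrow> i = j" "b i = b j \<longleftrightarrow> i = j" "a i \<noteq> b j" "b j \<noteq> a i" for i j
      by (rule two_level_distinct[OF 4]; auto)+
    show ?thesis
      by (rule emb[of AB Q2 "case_q_elem a b undefined"])
        (use 4 d in \<open>auto simp: Q_family_def AB_def Q2_def inj_on_def two_level_def\<close>)
  next
    case 5
    have d: "a i = a j \<longleftrightarrow> i = j" "b i = b j \<longleftrightarrow> i = j" "a i \<noteq> b j" "b j \<noteq> a i" for i j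
      by (rule two_level_distinct[OF 5(1)]; auto)+
    \<comment> \<open>\<open>c\<close> differs from \<open>a i\<close> because it is also below
      \<open>b (Suc i)\<close>.\<close>
    have "\<not> ?lt (a i) (b (Suc i))" for i using 5(1) by (simp add: two_level_def)
    then have c: "c \<noteq> a i" "a i \<noteq> c" "c \<noteq> b i" "b i \<noteq> c" for i
      using 5(3)[of "Suc i"] 5(3)[of i] by auto
    show ?thesis
      by (rule emb[of ABC Q3 "case_q_elem a b c"])
        (use 5 d c in \<open>auto simp: Q_family_def ABC_def Q3_def inj_on_def two_level_def\<close>)
  next
    case 6
    have d: "a i = a j \<longleftrightarrow> i = j" "b i = b j \<longleftrightarrow> i = j" "a i \<noteq> b j" "b j \<noteq> a i" for i j
      by (rule two_level_distinct[OF 6(1)]; auto)+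
    have "\<not> ?lt (a (Suc i)) (b i)" for i using 6(1) by (simp add: two_level_def)
    then have c: "c \<noteq> b i" "b i \<noteq> c" "c \<noteq> a i" "a i \<noteq> c" for i
      using 6(3)[of "Suc i"] 6(3)[of i] by auto
    show ?thesis
      by (rule emb[of ABC "Q3\<inverse>" "case_q_elem b a c"])
        (use 6 d c in \<open>auto simp: Q_family_def ABC_def Q3_def inj_on_def two_level_def\<close>)
  qed
qed

theorem theorem5:
  fixes V :: "'a set" and r :: "'a rel"
  assumes "prime_poset V r"
    and "infinite V"
    and "\<not> (\<exists>K \<in> Chains r. infinite K)"
  shows "\<exists>(W, s) \<in> Q_family. embeds_poset V r W s"
proof -
  have "unavoidable V (\<lambda>x y. (x, y) \<in> r - Id)"
    by (rule prime_order.unavoidable_prime_order[OF prime_poset_prime_order[OF assms]])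
  then show ?thesis
    using embeds_of_unavoidable assms(1) by (auto simp: prime_poset_def)
qed

end
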